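(* Let $Q\subseteq\mathbb{R}^n$ be a closed convex set and $f:Q\to\mathbb{R}$ a convex function attaining its minimum $f^*=\min_{x\in Q}f(x)$. Suppose that for some $\varepsilon>0$ there exists a bounded set $E_\varepsilon\subset\mathbb{R}^n$ with $\mathrm{Opt}_\varepsilon\subset E_\varepsilon+S$, where $\mathrm{Opt}_\varepsilon:=\{x\in Q: f(x)\le f^*+\varepsilon\}$ and $S$ is the recession cone of $\mathrm{Opt}_\varepsilon$. Then for any given strict lower bound $f_{\mathrm{slb}}<f^*$, the growth constant $$G=\sup_{x\in Q}\frac{\mathrm{Dist}(x,\mathrm{Opt})}{f(x)-f_{\mathrm{slb}}}$$ is finite.
   Context: The norm is Euclidean. $\mathrm{Opt}:=\{x\in Q: f(x)=f^*\}$ (nonempty), and $\mathrm{Dist}(x,\mathrm{Opt}):=\inf\{\|y-x\|: y\in\mathrm{Opt}\}$. The recession cone of $\mathrm{Opt}_\varepsilon$ is $S:=\{d\in\mathbb{R}^n: x+\theta d\in Q \text{ and } f(x+\theta d)\le f^*+\varepsilon \text{ for all } x\in\mathrm{Opt}_\varepsilon \text{ and all }\theta\ge 0\}$. *)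

theory Defs
  imports "HOL-Analysis.Analysis"
begin

text \<open>
  A function \<open>f : Q \<rightarrow> \<real>\<close> is modelled by a total function of which only the values on \<open>Q\<close> are used.
\<close>

definition level_set :: "(real^'n) set \<Rightarrow> (real^'n \<Rightarrow> real) \<Rightarrow> real \<Rightarrow> (real^'n) set" where
  "level_set Q f c = {x \<in> Q. f x \<le> c}"

definition opt_set :: "(real^'n) set \<Rightarrow> (real^'n \<Rightarrow> real) \<Rightarrow> real \<Rightarrow> (real^'n) set" where
  "opt_set Q f fstar = {x \<in> Q. f x = fstar}"

definition recession_cone :: "(real^'n) set \<Rightarrow> (real^'n) set" where
  "recession_cone C = {d. \<forall>x\<in>C. \<forall>\<theta>\<ge>0. x + \<theta> *\<^sub>R d \<in> C}"

text \<open>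
  The supremum is taken in the extended reals, since on \<^typ>\<open>real\<close> the supremum of an unbounded set
  is an unspecified real number.
\<close>

definition growth_constant ::
  "(real^'n) set \<Rightarrow> (real^'n \<Rightarrow> real) \<Rightarrow> real \<Rightarrow> real \<Rightarrow> ereal" where
  "growth_constant Q f fstar fslb =
     (SUP x\<in>Q. ereal (infdist x (opt_set Q f fstar) / (f x - fslb)))"

end

(* A convex function bounded above along a ray cannot increase along it, so every recession
   direction of the level set at height \<epsilon> is also one of the optimal set. Scaling the segment from
   a minimiser z to x down into that level set and decomposing the result as e + s with e \<in> E and
   s \<in> S, one scales back: z + s/\<lambda> is optimal and lies within |e - z|/\<lambda> of x. With
   \<lambda> = \<epsilon> / (\<epsilon> + f x - fstar) this distance grows at most linearly in f x. *)
theory Submission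
  imports Defs
begin

lemma recession_cone_scaleR:
  assumes "d \<in> recession_cone C" "c \<ge> 0"
  shows "c *\<^sub>R d \<in> recession_cone C"
  using assms by (simp add: recession_cone_def)

text \<open>For t \<ge> 1, \<open>x + d\<close> is a convex combination of \<open>x\<close> and the
  point \<open>x + t *\<^sub>R d\<close>, with weight \<open>1/t\<close> on the latter. The whole
  ray stays in the level set, so by convexity \<open>f (x + d)\<close> exceeds \<open>fstar\<close>
  by at most \<open>\<epsilon> / t\<close>, which is arbitrarily small.\<close>

lemma opt_set_plus_recession_direction:
  fixes Q :: "(real^'n) set"
  assumes cf: "convex_on Q f" and min: "\<forall>x\<in>Q. fstar \<le> f x" and "\<epsilon> > 0"
    and x: "x \<in> opt_set Q f fstar"
    and d: "d \<in> recession_cone (level_set Q f (fstar + \<epsilon>))"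
  shows "x + d \<in> opt_set Q f fstar"
proof -
  have xQ: "x \<in> Q" and fx: "f x = fstar" using x by (auto simp: opt_set_def)
  have "x \<in> level_set Q f (fstar + \<epsilon>)" using xQ fx \<open>\<epsilon> > 0\<close> by (simp add: level_set_def)
  then have ray: "x + t *\<^sub>R d \<in> level_set Q f (fstar + \<epsilon>)" if "t \<ge> 0" for t
    using d that by (auto simp: recession_cone_def)
  have xdQ: "x + d \<in> Q" using ray[of 1] by (simp add: level_set_def)
  have "f (x + d) \<le> fstar + e" if "e > 0" for e
  proof -
    \<comment> \<open>Going out to \<open>\<epsilon> / e\<close> brings the excess down to
      \<open>e\<close>; the maximum with 1 keeps \<open>1/t\<close> a valid convex weight.\<close>
    define t where "t = max 1 (\<epsilon> / e)"
    have t: "t \<ge> 1" "\<epsilon> / t \<le> e"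
      using that \<open>\<epsilon> > 0\<close> by (auto simp: t_def field_simps max_def)
    have y: "x + t *\<^sub>R d \<in> Q" "f (x + t *\<^sub>R d) \<le> fstar + \<epsilon>"
      using ray[of t] t by (auto simp: level_set_def)
    have "f (x + d) = f ((1 - 1/t) *\<^sub>R x + (1/t) *\<^sub>R (x + t *\<^sub>R d))"
      using t by (simp add: algebra_simps)
    also have "\<dots> \<le> (1 - 1/t) * f x + (1/t) * f (x + t *\<^sub>R d)"
      using t xQ y by (intro convex_onD[OF cf]) auto
    also have "\<dots> \<le> (1 - 1/t) * fstar + (1/t) * (fstar + \<epsilon>)"
      using t y fx by (intro add_mono mult_left_mono) auto
    also have "\<dots> = fstar + \<epsilon> / t" using t by (simp add: field_simps)
    finally show ?thesis using t by linarith
  qed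
  then have "f (x + d) \<le> fstar" by (rule field_le_epsilon)
  then show ?thesis using min xdQ by (force simp: opt_set_def)
qed

text \<open>The bound is \<open>D / l\<close> for the scaling factor \<open>l\<close> chosen below.
  Being affine in \<open>f x - fstar\<close>, it can be compared with a multiple of
  \<open>f x - fslb\<close>.\<close>

lemma infdist_opt_set_le:
  fixes Q :: "(real^'n) set"
  assumes cf: "convex_on Q f" and min: "\<forall>x\<in>Q. fstar \<le> f x" and \<epsilon>: "\<epsilon> > 0"
    and sub: "level_set Q f (fstar + \<epsilon>) \<subseteq> E + recession_cone (level_set Q f (fstar + \<epsilon>))"
    and z: "z \<in> opt_set Q f fstar" and D: "\<And>e. e \<in> E \<Longrightarrow> norm (e - z) \<le> D"
    and x: "x \<in> Q"
  shows "infdist x (opt_set Q f fstar) \<le> D * (1 + (f x - fstar) / \<epsilon>)"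
proof -
  have zQ: "z \<in> Q" and fz: "f z = fstar" using z by (auto simp: opt_set_def)
  define g where "g = f x - fstar"
  have g: "g \<ge> 0" using min x by (simp add: g_def)
  \<comment> \<open>This factor lies in (0, 1] and satisfies \<open>l * g \<le> \<epsilon>\<close>
    for every \<open>g \<ge> 0\<close>, so no case split on whether \<open>x\<close> is already in
    the level set arises, and \<open>1 / l\<close> is affine in \<open>g\<close>.\<close>
  define l where "l = \<epsilon> / (\<epsilon> + g)"
  have l: "l > 0" "l \<le> 1" using \<epsilon> g by (auto simp: l_def field_simps)
  have linv: "1 / l = 1 + g / \<epsilon>" using \<epsilon> g by (simp add: l_def field_simps)
  have "l * g \<le> \<epsilon>" using \<epsilon> g by (simp add: l_def field_simps)
  define y where "y = (1 - l) *\<^sub>R z + l *\<^sub>R x"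
  have yQ: "y \<in> Q" unfolding y_def
    using convex_on_imp_convex[OF cf] zQ x l by (intro convexD) auto
  have "f y \<le> (1 - l) * f z + l * f x"
    unfolding y_def using l zQ x by (intro convex_onD[OF cf]) auto
  also have "\<dots> = fstar + l * g" by (simp add: fz g_def algebra_simps)
  finally have "y \<in> level_set Q f (fstar + \<epsilon>)"
    using yQ \<open>l * g \<le> \<epsilon>\<close> by (simp add: level_set_def)
  then obtain e s where es: "e \<in> E" "s \<in> recession_cone (level_set Q f (fstar + \<epsilon>))" "y = e + s"
    using sub by (meson set_plus_elim subsetD)
  have opt: "z + (1/l) *\<^sub>R s \<in> opt_set Q f fstar"
    using es l by (intro opt_set_plus_recession_direction[OF cf min \<epsilon> z] recession_cone_scaleR) auto
  \<comment> \<open>Undoing the contraction towards \<open>z\<close> and substituting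
    \<open>y = e + s\<close>, the term \<open>(1/l) *\<^sub>R s\<close> cancels, leaving only the
    bounded part \<open>e - z\<close>, magnified by \<open>1/l\<close>.\<close>
  have "x - z = (1/l) *\<^sub>R (y - z)"
    using l by (simp add: y_def algebra_simps)
  then have "x - (z + (1/l) *\<^sub>R s) = (1/l) *\<^sub>R (e - z)"
    by (simp add: es(3) algebra_simps)
  then have "dist x (z + (1/l) *\<^sub>R s) = norm (e - z) * (1/l)"
    using l by (simp add: dist_norm)
  also have "\<dots> \<le> D * (1/l)" using D[OF es(1)] l by (intro mult_right_mono) auto
  finally show ?thesis
    using infdist_le[OF opt, of x] unfolding linv g_def by linarith
qed

theorem theorem1p1:
  fixes Q :: "(real^'n) set" and f :: "real^'n \<Rightarrow> real" and fstar fslb :: real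
  assumes "closed Q" and "convex Q"
    and "convex_on Q f"
    and "fstar \<in> f ` Q" and "\<forall>x\<in>Q. fstar \<le> f x"
    and "\<exists>\<epsilon>>0. \<exists>E. bounded E \<and>
           level_set Q f (fstar + \<epsilon>) \<subseteq> E + recession_cone (level_set Q f (fstar + \<epsilon>))"
    and "fslb < fstar"
  shows "\<bar>growth_constant Q f fstar fslb\<bar> \<noteq> \<infinity>"
proof -
  obtain \<epsilon> E where \<epsilon>: "\<epsilon> > 0" and E: "bounded E"
    and sub: "level_set Q f (fstar + \<epsilon>) \<subseteq> E + recession_cone (level_set Q f (fstar + \<epsilon>))"
    using assms(6) by blast
  obtain z where zQ: "z \<in> Q" and fz: "f z = fstar" using assms(4) by auto
  then have z: "z \<in> opt_set Q f fstar" by (simp add: opt_set_def)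
  obtain B where B: "B > 0" "\<And>e. e \<in> E \<Longrightarrow> norm e \<le> B" using E bounded_pos by blast
  define D where "D = B + norm z"
  have D: "D \<ge> 0" "\<And>e. e \<in> E \<Longrightarrow> norm (e - z) \<le> D"
    using B by (auto simp: D_def intro: order_trans[OF norm_triangle_ineq4])
  \<comment> \<open>The first summand absorbs the constant 1, since \<open>f x - fslb\<close> is at
    least the positive gap \<open>fstar - fslb\<close>; the second absorbs the slope
    \<open>1 / \<epsilon>\<close>.\<close>
  define K where "K = D * (1 / (fstar - fslb) + 1 / \<epsilon>)"
  define r where "r x = infdist x (opt_set Q f fstar) / (f x - fslb)" for x
  have upper: "r x \<le> K" if x: "x \<in> Q" for x
  proof -
    have fx: "fstar \<le> f x" using assms(5) x by blast
    have "1 \<le> (f x - fslb) / (fstar - fslb)" using fx \<open>fslb < fstar\<close> by (simp add: field_simps)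
    moreover have "(f x - fstar) / \<epsilon> \<le> (f x - fslb) / \<epsilon>"
      using \<open>fslb < fstar\<close> \<epsilon> by (intro divide_right_mono) auto
    ultimately have
      "1 + (f x - fstar) / \<epsilon> \<le> (1 / (fstar - fslb) + 1 / \<epsilon>) * (f x - fslb)"
      by (simp add: distrib_right)
    then have "D * (1 + (f x - fstar) / \<epsilon>) \<le> K * (f x - fslb)"
      unfolding K_def mult.assoc using D(1) by (rule mult_left_mono)
    with infdist_opt_set_le[OF assms(3,5) \<epsilon> sub z D(2) x]
    have "infdist x (opt_set Q f fstar) \<le> K * (f x - fslb)" by linarith
    then show ?thesis using fx \<open>fslb < fstar\<close> by (simp add: r_def divide_le_eq)
  qed
  have G: "growth_constant Q f fstar fslb = (SUP x\<in>Q. ereal (r x))"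
    by (simp add: growth_constant_def r_def)
  have "growth_constant Q f fstar fslb \<le> ereal K"
    unfolding G using upper by (intro SUP_least) simp
  \<comment> \<open>Finiteness in \<open>ereal\<close> also excludes -\<infinity>, and one real term
    of the supremum settles that.\<close>
  moreover have "ereal (r z) \<le> growth_constant Q f fstar fslb"
    unfolding G using zQ by (rule SUP_upper)
  ultimately show ?thesis by auto
qed

end
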